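(* Let $X$ be a dense-in-itself metric space. (1) Let $\mathbb T,\mathbb U$ be open subsets of $X$ with $\emptyset\neq\mathbb T\subseteq\mathbb U$. Let $k<\omega$. Then there are pairwise disjoint non-empty subsets $\mathbb I_0,\dots,\mathbb I_k\subseteq\mathbb T$ satisfying $\langle d\rangle\mathbb I_i=\mathrm{cl}(\mathbb T)\setminus\mathbb U$ for each $i\le k$. (2) Let $\mathbb G$ be a non-empty open subset of $X$, and let $r,s<\omega$. Then $\mathbb G$ can be partitioned into non-empty open subsets $\mathbb G_1,\dots,\mathbb G_r$ and other non-empty sets $\mathbb B_0,\dots,\mathbb B_s$ such that, letting $D=\mathrm{cl}(\mathbb G)\setminus\bigcup_{1\le l\le r}\mathbb G_l$, we have $\mathrm{cl}(\mathbb G_i)\setminus\mathbb G_i=D$ for each $i=1,\dots,r$, and $\langle d\rangle\mathbb B_j=D$ for each $j=0,\dots,s$.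
   Context: A metric space is regarded as a topological space with its metric topology; it is dense in itself if no singleton subset is open. $\mathrm{cl}$ is closure in $X$. For $S\subseteq X$, $\langle d\rangle S=\{x\in X: S\cap O\setminus\{x\}\neq\emptyset\text{ for every open neighbourhood }O\text{ of }x\}$ is the derivative (set of strict limit points) of $S$. $\omega$ is the set of natural numbers $\{0,1,2,\dots\}$; $r=0$ is allowed, in which case there are no sets $\mathbb G_i$. *)

theory Defs
  imports "HOL-Analysis.Analysis"
begin

definition dense_in_itself :: "'a topology \<Rightarrow> bool" where
  "dense_in_itself X \<longleftrightarrow> (\<forall>x\<in>topspace X. \<not> openin X {x})"

end

theory Submission
  imports Defs
begin

text \<open>
  Write \<open>d Q\<close> for the derived set of \<open>Q\<close>. Everything rests on maximal \<open>e\<close>-separated sets. Such a set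
  has no limit points, so removing it from \<open>Q\<close> does not change \<open>d Q\<close>, and by maximality it comes
  within \<open>e\<close> of every point of \<open>Q\<close>. This has two consequences in an arbitrary metric space.

  \<^item> Any set \<open>Q\<close> splits into finitely many pieces all having the derived set \<open>d Q\<close>
    (\<open>split_preserving_derived_set\<close>): remove nets of mesh \<open>1, 1/2, 1/3, \<dots>\<close> one after the other
    and deal them out cyclically to the pieces.
  \<^item> Any closed set \<open>F\<close> contained in the closure of \<open>T\<close> and disjoint from \<open>T\<close> is \<open>d Z\<close> for some
    \<open>Z \<subseteq> T\<close> (\<open>exists_subset_derived_set_eq\<close>): collect, for all \<open>n\<close>, a \<open>1/n\<close>-net of the points
    of \<open>T\<close> that are within \<open>1/n\<close> of \<open>F\<close>.

  For the first claim, apply the second fact to \<open>F = cl T - U\<close> and split the result. If \<open>F\<close> is empty,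
  singletons do, since non-empty open sets are infinite.

  For the second claim with \<open>r > 0\<close>, the set \<open>D\<close> is the closure of an increasing union of frontiers.
  Start with \<open>V\<^sub>0\<close>, the set \<open>G\<close> with one point deleted; the point guarantees a non-empty frontier.
  Given an open \<open>V\<^sub>n\<close> with frontier \<open>F\<^sub>n\<close>, the first claim yields \<open>r + 1\<close> disjoint subsets of \<open>V\<^sub>n\<close> with
  derived set \<open>F\<^sub>n\<close>, as near to \<open>F\<^sub>n\<close> as desired. One of them becomes a set \<open>E\<^sub>n\<close>; the other \<open>r\<close> are
  enclosed in disjoint open sets, which go to \<open>G\<^sub>1, \<dots>, G\<^sub>r\<close> respectively. What is left is an open
  \<open>V\<^sub>n\<^sub>+\<^sub>1\<close> whose frontier contains \<open>F\<^sub>n\<close>, \<open>E\<^sub>n\<close> and the boundaries of the new open sets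
  (\<open>exists_carving\<close>). In the limit each \<open>F\<^sub>n\<close> lies in the closure of each \<open>G\<^sub>i\<close> and in the derived
  set of \<open>E\<^sub>n \<subseteq> G \<inter> D\<close>, hence so does \<open>D\<close>. Since the sets removed at step \<open>n\<close> are within \<open>1/(n+1)\<close> of
  \<open>F\<^sub>n\<close>, the points outside \<open>D\<close> that are never removed form an open set, which is added to \<open>G\<^sub>1\<close>.
  Finally \<open>G \<inter> D\<close> has derived set \<open>D\<close>, and splitting it gives the sets \<open>B\<^sub>j\<close>. For \<open>r = 0\<close> the set \<open>G\<close>
  itself is split.
\<close>

section \<open>Separated nets\<close>

context Metric_space
begin

lemma in_derived_set_ofD:
  assumes "y \<in> mtopology derived_set_of S" "r > 0"
  shows "\<exists>x\<in>S. x \<noteq> y \<and> x \<in> mball y r"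
  using assms unfolding metric_derived_set_of by blast

definition separated :: "real \<Rightarrow> 'a set \<Rightarrow> bool" where
  "separated e A \<longleftrightarrow> A \<subseteq> M \<and> (\<forall>x\<in>A. \<forall>y\<in>A. x \<noteq> y \<longrightarrow> e \<le> d x y)"

text \<open>Two different points of a separated set cannot both be close to a third point.\<close>

lemma derived_set_of_separated:
  assumes "separated e A" "e > 0"
  shows "mtopology derived_set_of A = {}"
proof (rule ccontr)
  assume "mtopology derived_set_of A \<noteq> {}"
  then obtain y where "y \<in> mtopology derived_set_of A"
    by blast
  then have y: "y \<in> M" and lim: "\<And>r. r > 0 \<Longrightarrow> \<exists>a\<in>A. a \<noteq> y \<and> a \<in> mball y r"
    unfolding metric_derived_set_of by blast+
  obtain a where a: "a \<in> A" "a \<noteq> y" "a \<in> mball y (e/2)"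
    using lim[of "e/2"] \<open>e > 0\<close> by auto
  have "d y a > 0"
    using a y by auto
  then obtain b where b: "b \<in> A" "b \<noteq> y" "b \<in> mball y (min (e/2) (d y a))"
    using lim[of "min (e/2) (d y a)"] \<open>e > 0\<close> by auto
  then have "b \<noteq> a" "d a b < e"
    using a triangle[of a y b] by (auto simp: commute)
  then show False
    using assms a b by (force simp: separated_def)
qed

text \<open>A maximal separated subset, given by Zorn's lemma, is a net: a point far from it could be added.\<close>

lemma exists_separated_net:
  assumes "Q \<subseteq> M"
  obtains A where "A \<subseteq> Q" "separated e A" "\<And>q. q \<in> Q \<Longrightarrow> q \<in> A \<or> (\<exists>a\<in>A. d a q < e)"
proof -
  define \<A> where "\<A> = {A. A \<subseteq> Q \<and> separated e A}"
  have "\<exists>A\<in>\<A>. \<forall>B\<in>\<A>. A \<subseteq> B \<longrightarrow> B = A"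
  proof (rule subset_Zorn')
    fix C assume C: "subset.chain \<A> C"
    have "e \<le> d x y" if xy: "x \<in> \<Union>C" "y \<in> \<Union>C" "x \<noteq> y" for x y
    proof -
      obtain S S' where S: "S \<in> C" "S' \<in> C" "x \<in> S" "y \<in> S'"
        using xy by blast
      then consider "S \<subseteq> S'" | "S' \<subseteq> S"
        using C by (auto simp: subset.chain_def)
      then show ?thesis
        using C S xy(3) by cases (auto simp: subset.chain_def \<A>_def separated_def subset_iff)
    qed
    then show "\<Union>C \<in> \<A>"
      using C assms by (auto simp: \<A>_def separated_def subset.chain_def)
  qed
  then obtain A where "A \<in> \<A>" and max\<A>: "\<And>B. B \<in> \<A> \<Longrightarrow> A \<subseteq> B \<Longrightarrow> B = A"
    by meson
  then have A: "A \<subseteq> Q" "separated e A"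
    by (simp_all add: \<A>_def)
  have max: "B = A" if "B \<subseteq> Q" "separated e B" "A \<subseteq> B" for B
    using max\<A> that by (simp add: \<A>_def)
  show ?thesis
  proof
    fix q assume q: "q \<in> Q"
    show "q \<in> A \<or> (\<exists>a\<in>A. d a q < e)"
    proof (rule ccontr)
      assume neg: "\<not> ?thesis"
      then have "separated e (insert q A)"
        using A(2) q assms by (auto simp: separated_def not_less commute)
      then show False
        using max[of "insert q A"] neg q A(1) by auto
    qed
  qed (use A in auto)
qed

section \<open>Splitting a set without changing its derived set\<close>

text \<open>Remove from \<open>Q\<close> successive nets of mesh \<open>1, 1/2, 1/3, \<dots>\<close>. Having no limit points, the removed nets
do not affect the derived set of what remains, so each of the nets still comes arbitrarily near every limit
point of \<open>Q\<close> as its mesh shrinks. Piece \<open>j\<close> receives the nets with index congruent to \<open>j\<close> modulo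
\<open>k + 1\<close>, an infinite supply.\<close>

lemma split_preserving_derived_set:
  assumes "Q \<subseteq> M"
  obtains B :: "nat \<Rightarrow> 'a set" where
    "disjoint_family_on B {0..k}" "(\<Union>j\<in>{0..k}. B j) = Q"
    "\<And>j. j \<in> {0..k} \<Longrightarrow> mtopology derived_set_of B j = mtopology derived_set_of Q"
proof -
  let ?d = "\<lambda>S. mtopology derived_set_of S"
  \<comment> \<open>\<open>R n\<close> is what remains of \<open>Q\<close> after \<open>n\<close> nets have been removed.\<close>
  define P where "P = (\<lambda>(n::nat) R. R \<subseteq> Q \<and> ?d Q \<subseteq> ?d R)"
  define step where "step = (\<lambda>(n::nat) R R'. R' \<subseteq> R \<and>
    (\<forall>q\<in>R. \<exists>a\<in>R - R'. a = q \<or> d a q < 1 / Suc n))"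
  have "\<exists>R. \<forall>n. P n (R n) \<and> step n (R n) (R (Suc n))"
  proof (rule dependent_nat_choice)
    show "\<exists>R. P 0 R"
      by (auto simp: P_def)
    fix R n assume R: "P n R"
    then obtain A where A: "A \<subseteq> R" "separated (1 / Suc n) A"
        "\<And>q. q \<in> R \<Longrightarrow> q \<in> A \<or> (\<exists>a\<in>A. d a q < 1 / Suc n)"
      using exists_separated_net[of R "1 / Suc n"] assms by (auto simp: P_def)
    have "?d R = ?d A \<union> ?d (R - A)"
      using A(1) by (metis derived_set_of_Un Un_Diff_cancel sup.absorb2)
    then have "?d R = ?d (R - A)"
      using derived_set_of_separated[OF A(2)] by simp
    then have "P (Suc n) (R - A)"
      using R by (auto simp: P_def)
    moreover have "step n R (R - A)"
      using A(1,3) unfolding step_def by (metis Diff_subset double_diff order_refl)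
    ultimately show "\<exists>R'. P (Suc n) R' \<and> step n R R'"
      by blast
  qed
  then obtain R where "\<And>n. P n (R n)" and step: "\<And>n. step n (R n) (R (Suc n))"
    by metis
  then have R: "R n \<subseteq> Q" "?d Q \<subseteq> ?d (R n)" "R (Suc n) \<subseteq> R n" for n
    by (simp_all add: P_def step_def)
  have net: "\<exists>a\<in>R n - R (Suc n). a = q \<or> d a q < 1 / Suc n" if "q \<in> R n" for n q
    using step[of n] that by (simp add: step_def)
  define A where "A n = R n - R (Suc n)" for n
  have anti: "R n \<subseteq> R m" if "m \<le> n" for m n
    using R(3) that by (rule lift_Suc_antimono_le)
  have A_disj: "A m \<inter> A n = {}" if "m < n" for m n
    using anti[of "Suc m" n] that by (auto simp: A_def)
  have A_uniq: "m = n" if "x \<in> A m" "x \<in> A n" for x m n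
    using A_disj[of m n] A_disj[of n m] that by (metis disjoint_iff linorder_neqE_nat)
  define C where "C j = (\<Union>n\<in>{n. n mod Suc k = j}. A n)" for j
  have C_disj: "C i \<inter> C j = {}" if "i \<noteq> j" for i j
    using A_uniq that by (auto simp: C_def)
  have CQ: "C j \<subseteq> Q" for j
    using R(1) by (auto simp: C_def A_def)
  have dC: "?d Q \<subseteq> ?d (C j)" if "j \<le> k" for j
  proof
    fix y assume y: "y \<in> ?d Q"
    then have yM: "y \<in> M"
      by (auto simp: metric_derived_set_of)
    have "\<exists>a\<in>C j. a \<noteq> y \<and> a \<in> mball y r" if "r > 0" for r
    proof -
      \<comment> \<open>At most one of the nets contains \<open>y\<close>; a late net of the class \<open>j\<close> avoids it.\<close>
      obtain N where N: "\<And>n. n \<ge> N \<Longrightarrow> y \<notin> A n"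
        by (metis A_uniq not_less_eq_eq)
      obtain N' where N': "1 / Suc N' < r / 2"
        using \<open>r > 0\<close> nat_approx_posE[of "r/2"] by auto
      define n where "n = j + (N + N') * Suc k"
      have n: "n \<ge> N" "n \<ge> N'"
        by (auto simp: n_def)
      have nj: "n mod Suc k = j"
        using \<open>j \<le> k\<close> unfolding n_def by (simp only: mod_mult_self1) simp
      have small: "1 / Suc n < r / 2"
        using N' n(2) by (smt (verit, best) Suc_le_mono frac_le of_nat_0_less_iff of_nat_mono zero_less_Suc)
      obtain q where q: "q \<in> R n" "q \<in> mball y (r/2)"
        using in_derived_set_ofD[of y "R n" "r/2"] R(2)[of n] y \<open>r > 0\<close> by auto
      obtain a where a: "a \<in> A n" "a = q \<or> d a q < 1 / Suc n"
        using net[OF q(1)] unfolding A_def by blast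
      have aM: "a \<in> M"
        using a(1) R(1)[of n] assms by (auto simp: A_def)
      have "d y a < r"
        using a(2) q(2) small triangle[of y q a] aM \<open>r > 0\<close> by (auto simp: commute)
      then show ?thesis
        using a(1) N[OF n(1)] nj aM yM unfolding C_def by auto
    qed
    then show "y \<in> ?d (C j)"
      using yM by (auto simp: metric_derived_set_of)
  qed
  \<comment> \<open>Points of \<open>Q\<close> outside all the nets go to the piece number 0.\<close>
  define B where "B j = (if j = 0 then Q - (\<Union>i\<in>{1..k}. C i) else C j)" for j
  have CB: "C j \<subseteq> B j" for j
    using CQ C_disj[of 0] by (auto simp: B_def disjoint_iff) 
  have BQ: "B j \<subseteq> Q" for j
    using CQ by (auto simp: B_def)
  show ?thesis
  proof
    show "disjoint_family_on B {0..k}"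
      using C_disj by (auto simp: disjoint_family_on_def B_def)
    show "(\<Union>j\<in>{0..k}. B j) = Q"
    proof
      show "Q \<subseteq> (\<Union>j\<in>{0..k}. B j)"
      proof
        fix x assume x: "x \<in> Q"
        show "x \<in> (\<Union>j\<in>{0..k}. B j)"
        proof (cases "x \<in> (\<Union>i\<in>{1..k}. C i)")
          case True
          then obtain i where "i \<in> {1..k}" "x \<in> C i" by blast
          then show ?thesis using CB[of i] by auto
        next
          case False
          then have "x \<in> B 0" using x by (simp add: B_def)
          then show ?thesis by auto
        qed
      qed
    qed (use BQ in auto)
    show "?d (B j) = ?d Q" if "j \<in> {0..k}" for j
      using dC[of j] derived_set_of_mono[OF CB] derived_set_of_mono[OF BQ] that
      by (meson atLeastAtMost_iff order_trans subset_antisym)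
  qed
qed

section \<open>Disjoint sets with a prescribed derived set\<close>

text \<open>Take the union over \<open>n\<close> of nets \<open>A n\<close> of mesh \<open>1/(n+1)\<close> in the part \<open>W n\<close> of \<open>T\<close> within \<open>1/(n+1)\<close> of
\<open>F\<close>. Every point of \<open>F\<close> is a limit, because \<open>W n\<close> has points near it and the net has points near
those. A point off the closed set \<open>F\<close> has a neighbourhood that meets only finitely many of the \<open>A n\<close>, and
these have no limit points.\<close>

lemma exists_subset_derived_set_eq:
  assumes F: "closedin mtopology F" "F \<subseteq> mtopology closure_of T" and FT: "F \<inter> T = {}" and T: "T \<subseteq> M"
  obtains Z where "Z \<subseteq> T" "mtopology derived_set_of Z = F"
proof -
  have FM: "F \<subseteq> M"
    using closedin_subset[OF F(1)] by simp
  define W where "W n = {t\<in>T. \<exists>y\<in>F. d y t < 1 / Suc n}" for n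
  have "\<exists>A. A \<subseteq> W n \<and> separated (1 / Suc n) A \<and> (\<forall>q\<in>W n. q \<in> A \<or> (\<exists>a\<in>A. d a q < 1 / Suc n))" for n
  proof -
    have "W n \<subseteq> M" using T by (auto simp: W_def)
    then show ?thesis
      by (rule exists_separated_net[of "W n" "1 / Suc n"]) blast
  qed
  then obtain A where A: "\<And>n. A n \<subseteq> W n" "\<And>n. separated (1 / Suc n) (A n)"
      "\<And>n q. q \<in> W n \<Longrightarrow> q \<in> A n \<or> (\<exists>a\<in>A n. d a q < 1 / Suc n)"
    by metis
  define Z where "Z = (\<Union>n. A n)"
  have ZT: "Z \<subseteq> T"
    using A(1) by (auto simp: Z_def W_def)
  have small: "1 / Suc n \<le> 1 / Suc N" if "N \<le> n" for n N
    using that by (simp add: frac_le)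
  have sub: "F \<subseteq> mtopology derived_set_of Z"
  proof
    fix y assume y: "y \<in> F"
    then have yM: "y \<in> M" using FM by auto
    have "\<exists>a\<in>Z. a \<noteq> y \<and> a \<in> mball y r" if "r > 0" for r
    proof -
      obtain n where n: "1 / Suc n < r / 2"
        using \<open>r > 0\<close> nat_approx_posE[of "r/2"] by auto
      have "y \<in> mtopology closure_of T"
        using y F by auto
      moreover have "1 / real (Suc n) > 0"
        by simp
      ultimately obtain t where t: "t \<in> T" "t \<in> mball y (1 / Suc n)"
        unfolding metric_closure_of by blast
      then have "t \<in> W n"
        using y by (auto simp: W_def)
      then obtain a where a: "a \<in> A n" "a = t \<or> d a t < 1 / Suc n"
        using A(3) by blast
      have "a \<in> Z" using a(1) by (auto simp: Z_def)
      then have "a \<in> M" "a \<noteq> y" using ZT T FT y by auto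
      moreover have "d y a < r"
        using a(2) t n triangle[of y t a] \<open>a \<in> M\<close> \<open>r > 0\<close>
        unfolding in_mball commute[of a t] by force
      ultimately show ?thesis
        using \<open>a \<in> Z\<close> yM by auto
    qed
    then show "y \<in> mtopology derived_set_of Z"
      using yM by (auto simp: metric_derived_set_of)
  qed
  have "mtopology derived_set_of Z \<subseteq> F"
  proof
    fix y assume y: "y \<in> mtopology derived_set_of Z"
    show "y \<in> F"
    proof (rule ccontr)
      assume "y \<notin> F"
      have yM: "y \<in> M" using y by (auto simp: metric_derived_set_of)
      have "openin mtopology (M - F)"
        using F(1) by (metis closedin_def topspace_mtopology)
      then obtain r where r: "r > 0" "mball y r \<subseteq> M - F"
        using \<open>y \<notin> F\<close> yM openin_mtopology by (metis DiffI)
      obtain N where N: "1 / Suc N < r / 2"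
        using \<open>r > 0\<close> nat_approx_posE[of "r/2"] by auto
      have far: "A n \<inter> mball y (r/2) = {}" if "N \<le> n" for n
      proof (rule ccontr)
        assume "A n \<inter> mball y (r/2) \<noteq> {}"
        then obtain z where z: "z \<in> W n" "z \<in> mball y (r/2)"
          using A(1)[of n] by blast
        then obtain x where x: "x \<in> F" "d x z < 1 / Suc n"
          by (auto simp: W_def)
        have "d y x < r"
          using z(2) x small[OF that] N triangle[of y z x] FM by (auto simp: commute)
        then have "x \<in> mball y r" using x FM yM by auto
        then show False using r x by blast
      qed
      have "mball y (r/2) \<inter> Z \<subseteq> \<Union>(A ` {..<N})"
      proof
        fix z assume z: "z \<in> mball y (r/2) \<inter> Z"
        then obtain n where "z \<in> A n"
          by (auto simp: Z_def)
        moreover from this have "n < N"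
          using far[of n] z by (cases "n < N") auto
        ultimately show "z \<in> \<Union>(A ` {..<N})"
          by blast
      qed
      then have "mtopology derived_set_of (mball y (r/2) \<inter> Z) \<subseteq> mtopology derived_set_of \<Union>(A ` {..<N})"
        by (rule derived_set_of_mono)
      also have "\<dots> = {}"
        using derived_set_of_separated[OF A(2)] by (simp add: derived_set_of_Union)
      finally have "mtopology derived_set_of (mball y (r/2) \<inter> Z) = {}"
        by simp
      moreover have "y \<in> mball y (r/2) \<inter> mtopology derived_set_of Z"
        using y yM r by simp
      ultimately show False
        using openin_Int_derived_set_of_subset[OF openin_mball] by blast
    qed
  qed
  with sub ZT that show ?thesis by blast
qed

lemma dense_in_itself_infinite_open:
  assumes "dense_in_itself mtopology" "openin mtopology T" "T \<noteq> {}"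
  shows "infinite T"
proof
  assume fin: "finite T"
  obtain x where x: "x \<in> T" using assms by auto
  have TM: "T \<subseteq> M" using openin_subset[OF assms(2)] by simp
  have "closedin mtopology (T - {x})"
    using fin TM by (auto intro!: closedin_Hausdorff_finite Hausdorff_space_mtopology)
  then have "openin mtopology (T - (T - {x}))"
    using assms(2) by blast
  moreover have "T - (T - {x}) = {x}" using x by auto
  ultimately show False
    using assms(1) x TM by (auto simp: dense_in_itself_def)
qed

text \<open>The target \<open>cl T - U\<close> is closed and disjoint from \<open>T\<close>, so it is the derived set of one subset of \<open>T\<close>,
which can be split. When the target is non-empty the pieces are non-empty automatically; otherwise any
\<open>k + 1\<close> distinct points of \<open>T\<close> serve as pieces.\<close>

proposition exists_disjoint_sets_derived_set_eq:
  assumes X: "dense_in_itself mtopology" and T: "openin mtopology T" "T \<noteq> {}" 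
      and U: "openin mtopology U" "T \<subseteq> U"
  obtains I :: "nat \<Rightarrow> 'a set" where "disjoint_family_on I {0..k}"
    "\<And>i. i \<in> {0..k} \<Longrightarrow> I i \<noteq> {} \<and> I i \<subseteq> T \<and>
             mtopology derived_set_of I i = (mtopology closure_of T) - U"
proof (cases "mtopology closure_of T - U = {}")
  case True
  obtain S where S: "S \<subseteq> T" "finite S" "card S = Suc k"
    using dense_in_itself_infinite_open[OF X T] by (meson infinite_arbitrarily_large)
  then obtain f where f: "bij_betw f {0..k} S"
    by (metis bij_betw_iff_card card_atLeastAtMost diff_zero finite_atLeastAtMost)
  show ?thesis
  proof (rule that[of "\<lambda>i. {f i}"])
    show "disjoint_family_on (\<lambda>i. {f i}) {0..k}"
      using f by (auto simp: disjoint_family_on_def bij_betw_def inj_on_def)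
    fix i assume "i \<in> {0..k}"
    then have "f i \<in> T"
      using f S(1) by (auto simp: bij_betw_def)
    moreover have "mtopology derived_set_of {f i} = {}"
      by (simp add: derived_set_of_finite Hausdorff_space_mtopology)
    ultimately show "{f i} \<noteq> {} \<and> {f i} \<subseteq> T \<and> mtopology derived_set_of {f i} = mtopology closure_of T - U"
      using True by simp
  qed
next
  case False
  have TM: "T \<subseteq> M" using openin_subset[OF T(1)] by simp
  obtain Z where Z: "Z \<subseteq> T" "mtopology derived_set_of Z = mtopology closure_of T - U"
  proof (rule exists_subset_derived_set_eq)
    show "closedin mtopology (mtopology closure_of T - U)"
      using U(1) by (simp add: closedin_diff)
  qed (use U TM in auto)
  obtain I :: "nat \<Rightarrow> 'a set" where I: "disjoint_family_on I {0..k}" "(\<Union>i\<in>{0..k}. I i) = Z"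
     "\<And>i. i \<in> {0..k} \<Longrightarrow> mtopology derived_set_of I i = mtopology derived_set_of Z"
    using split_preserving_derived_set[OF order_trans[OF Z(1) TM], of k] by metis
  show ?thesis
  proof (rule that[OF I(1)])
    fix i assume i: "i \<in> {0..k}"
    have "I i \<noteq> {}"
      using I(3)[OF i] Z(2) False by auto
    moreover have "I i \<subseteq> T"
      using I(2) i Z(1) by blast
    ultimately show "I i \<noteq> {} \<and> I i \<subseteq> T \<and> mtopology derived_set_of I i = mtopology closure_of T - U"
      using I(3)[OF i] Z(2) by simp
  qed
qed

lemma dense_in_itself_open_subset_derived_set:
  assumes "dense_in_itself mtopology" "openin mtopology G"
  shows "G \<subseteq> mtopology derived_set_of G"
proof
  fix x assume x: "x \<in> G"
  then have "x \<in> topspace mtopology"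
    using openin_subset[OF assms(2)] by blast
  moreover have "\<exists>y. y \<noteq> x \<and> y \<in> G \<and> y \<in> O'" if O': "x \<in> O'" "openin mtopology O'" for O'
  proof -
    have "openin mtopology (G \<inter> O')" "G \<inter> O' \<noteq> {}"
      using assms(2) O' x by auto
    then have "infinite (G \<inter> O')"
      by (rule dense_in_itself_infinite_open[OF assms(1)])
    then have "\<not> G \<inter> O' \<subseteq> {x}"
      using finite_subset by blast
    then show ?thesis by blast
  qed
  ultimately show "x \<in> mtopology derived_set_of G"
    by (auto simp: in_derived_set_of)
qed

section \<open>One step of the dissection\<close>

text \<open>The invariants of one step: the open set \<open>V\<close> shrinks to an open set \<open>V'\<close>, the open sets \<open>N i\<close> and the set
\<open>E\<close> being cut out. All that is cut out lies in \<open>W\<close>, which will be a narrow strip along the frontier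
of \<open>V\<close>. Apart from the \<open>N i\<close>, whatever leaves \<open>V\<close> ends up in the frontier of \<open>V'\<close>; this is what makes
the next step accumulate there too.\<close>

definition carves :: "nat \<Rightarrow> 'a set \<Rightarrow> 'a set \<Rightarrow> 'a set \<Rightarrow> 'a set \<Rightarrow> (nat \<Rightarrow> 'a set) \<Rightarrow> bool" where
  "carves r V W V' E N \<longleftrightarrow>
     openin mtopology V' \<and> V' \<subseteq> V \<and> V - V' \<subseteq> W \<and>
     mtopology frontier_of V \<subseteq> mtopology frontier_of V' \<and>
     V - V' - (\<Union>i\<in>{1..r}. N i) \<subseteq> mtopology frontier_of V' \<and>
     E \<subseteq> V \<inter> mtopology frontier_of V' \<and>
     mtopology frontier_of V \<subseteq> mtopology derived_set_of E \<and>
     disjoint_family_on N {1..r} \<and>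
     (\<forall>i\<in>{1..r}. openin mtopology (N i) \<and> N i \<subseteq> V - V' \<and>
        mtopology frontier_of V \<subseteq> mtopology closure_of N i)"

text \<open>A finite disjoint family of closed sets is a topological sum: the function that takes the value \<open>i\<close> on
\<open>S i\<close> is continuous, so that Tietze's theorem can extend it.\<close>

lemma continuous_indexing_closed_family:
  fixes S :: "nat \<Rightarrow> 'b set"
  assumes "finite J" "disjoint_family_on S J" "\<And>i. i \<in> J \<Longrightarrow> closedin Y (S i)"
  obtains g :: "'b \<Rightarrow> real" where
    "continuous_map (subtopology Y (\<Union>i\<in>J. S i)) euclideanreal g"
    "\<And>i x. i \<in> J \<Longrightarrow> x \<in> S i \<Longrightarrow> g x = real i"
proof -
  define g where "g x = real (THE i. i \<in> J \<and> x \<in> S i)" for x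
  have g: "g x = real i" if "i \<in> J" "x \<in> S i" for i x
  proof -
    have "(THE i. i \<in> J \<and> x \<in> S i) = i"
      using assms(2) that by (intro the_equality) (auto simp: disjoint_family_on_def)
    then show ?thesis by (simp add: g_def)
  qed
  let ?S = "\<Union>i\<in>J. S i"
  have top: "topspace (subtopology Y ?S) = ?S"
    using closedin_subset[OF assms(3)] by auto
  have "closedin (subtopology Y ?S) {x \<in> ?S. g x \<in> C}" for C
  proof -
    have "{x \<in> ?S. g x \<in> C} = \<Union>(S ` {i \<in> J. real i \<in> C})"
      using g by auto
    moreover have "closedin Y (\<Union>(S ` {i \<in> J. real i \<in> C}))"
      using assms(1,3) by (intro closedin_Union) auto
    ultimately show ?thesis
      by (metis (no_types, lifting) closedin_subset_topspace mem_Collect_eq subsetI)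
  qed
  then have "continuous_map (subtopology Y ?S) euclideanreal g"
    unfolding continuous_map_closedin top by simp
  then show ?thesis
    using that g by blast
qed

text \<open>Take disjoint sets \<open>I 0, \<dots>, I r\<close> in \<open>W\<close> whose derived set is the frontier of \<open>V\<close>. They are closed in
\<open>V\<close>, so Tietze's theorem gives a continuous \<open>f\<close> on \<open>V\<close> with value \<open>i\<close> on \<open>I i\<close> and value \<open>0\<close> outside
\<open>W\<close>. Cut out \<open>E = I 0\<close> and, for positive \<open>i\<close>, the sets \<open>P i\<close> on which \<open>f\<close> is within \<open>1/3\<close> of \<open>i\<close>; let
\<open>N i\<close> be the interior of \<open>P i\<close>. Each point of \<open>P i - N i\<close> is then a limit of points of \<open>V\<close> outside
\<open>P i\<close>, and once \<open>f\<close> is within \<open>1/2\<close> of \<open>i\<close> there, these avoid \<open>I 0\<close> and every other \<open>P j\<close>, so they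
belong to \<open>V'\<close>.\<close>

lemma exists_carving:
  assumes X: "dense_in_itself mtopology"
    and V: "openin mtopology V" and W: "openin mtopology W" "W \<subseteq> V"
    and F: "mtopology frontier_of V \<noteq> {}" "mtopology frontier_of V \<subseteq> mtopology closure_of W"
  shows "\<exists>V' E N. carves r V W V' E N"
proof -
  let ?F = "mtopology frontier_of V"
  have VM: "V \<subseteq> M"
    using openin_subset[OF V] by simp
  have frV: "?F = mtopology closure_of V - V"
    using V by (simp add: frontier_of_def interior_of_openin)
  have clWV: "mtopology closure_of W - V = ?F"
    using F(2) frV closure_of_mono[OF W(2)] by blast
  have "W \<noteq> {}"
    using F by auto
  obtain I :: "nat \<Rightarrow> 'a set" where disj: "disjoint_family_on I {0..r}"
    and "\<And>i. i \<in> {0..r} \<Longrightarrow> I i \<noteq> {} \<and> I i \<subseteq> W \<and> mtopology derived_set_of I i = mtopology closure_of W - V"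
    using exists_disjoint_sets_derived_set_eq[OF X W(1) \<open>W \<noteq> {}\<close> V W(2), of r] by metis
  then have IW: "I i \<subseteq> W" and dI: "mtopology derived_set_of I i = ?F" if "i \<in> {0..r}" for i
    using that clWV by auto
  let ?Y = "subtopology mtopology V"
  have topY: "topspace ?Y = V"
    using VM by auto
  have closedI: "closedin ?Y (I i)" if "i \<in> {0..r}" for i
    using IW[OF that] dI[OF that] W(2) VM frV by (auto simp: closedin_derived_set)
  \<comment> \<open>The complement of \<open>W\<close> joins \<open>I 0\<close>, so that the function below keeps away from
      the positive integers there.\<close>
  define S where "S i = (if i = 0 then I 0 \<union> (V - W) else I i)" for i
  have "closedin ?Y (V - W)"
    using W V by (metis closedin_diff closedin_topspace openin_open_subtopology topY)
  then have closedS: "closedin ?Y (S i)" if "i \<in> {0..r}" for i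
    using closedI[of 0] closedI[OF that] by (auto simp: S_def)
  have disjS: "disjoint_family_on S {0..r}"
    unfolding disjoint_family_on_def
  proof (intro ballI impI)
    fix i j assume ij: "i \<in> {0..r}" "j \<in> {0..r}" "i \<noteq> j"
    have "I i \<inter> I j = {}"
      using disj ij by (simp add: disjoint_family_on_def)
    moreover have "I i \<inter> (V - W) = {}" "I j \<inter> (V - W) = {}"
      using IW ij by blast+
    ultimately show "S i \<inter> S j = {}"
      using ij(3) by (cases "i = 0"; cases "j = 0") (simp_all add: S_def Int_Un_distrib Int_Un_distrib2 Int_commute)
  qed
  obtain g :: "'a \<Rightarrow> real" where g: "continuous_map (subtopology ?Y (\<Union>i\<in>{0..r}. S i)) euclideanreal g"
      "\<And>i x. i \<in> {0..r} \<Longrightarrow> x \<in> S i \<Longrightarrow> g x = real i"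
    using continuous_indexing_closed_family[OF _ disjS closedS] by (metis finite_atLeastAtMost)
  have "normal_space ?Y"
    by (simp add: metrizable_imp_normal_space metrizable_space_subtopology metrizable_space_mtopology)
  moreover have "closedin ?Y (\<Union>i\<in>{0..r}. S i)"
    using closedS by (intro closedin_Union) auto
  ultimately have "\<exists>f. continuous_map ?Y euclideanreal f \<and> (\<forall>x\<in>(\<Union>i\<in>{0..r}. S i). f x = g x)"
    using iffD1[OF normal_space_iff_Tietze, of ?Y, rule_format, OF _ conjI[OF _ g(1)]] by simp
  then obtain f :: "'a \<Rightarrow> real" where f: "continuous_map ?Y euclideanreal f"
      "\<And>x. x \<in> (\<Union>i\<in>{0..r}. S i) \<Longrightarrow> f x = g x"
    by metis
  have fS: "f x = real i" if "i \<in> {0..r}" "x \<in> S i" for i x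
    using f(2)[OF UN_I[of i "{0..r}" x S, OF that]] g(2)[OF that] by simp
  have fI: "f x = real i" if "i \<in> {0..r}" "x \<in> I i" for i x
  proof -
    have "x \<in> S i"
      using that by (auto simp: S_def)
    then show ?thesis
      using fS that by simp
  qed
  have f0: "f x = 0" if "x \<in> V - W" for x
    using fS[of 0 x] that by (auto simp: S_def)
  have open_pre: "openin mtopology {x \<in> V. \<bar>f x - a\<bar> < b}" for a b
  proof -
    have "openin ?Y {x \<in> topspace ?Y. f x \<in> {y. \<bar>y - a\<bar> < b}}"
      by (rule openin_continuous_map_preimage[OF f(1)])
         (auto intro!: open_Collect_less continuous_intros)
    then show ?thesis
      using V unfolding topY by (simp add: openin_open_subtopology)
  qed
  have apart: "i = j" if "\<bar>a - real i\<bar> < 1/2" "\<bar>a - real j\<bar> \<le> 1/3" for i j :: nat and a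
    using that by linarith
  define P where "P i = {x \<in> V. \<bar>f x - real i\<bar> \<le> 1/3}" for i
  define N where "N i = mtopology interior_of P i" for i
  define V' where "V' = V - (I 0 \<union> (\<Union>i\<in>{1..r}. P i))"
  have NP: "N i \<subseteq> P i" for i
    by (simp add: N_def interior_of_subset)
  have "closedin ?Y (P i)" for i
  proof -
    have "closedin ?Y {x \<in> topspace ?Y. f x \<in> {y. \<bar>y - real i\<bar> \<le> 1/3}}"
      by (rule closedin_continuous_map_preimage[OF f(1)])
         (auto intro!: closed_Collect_le continuous_intros)
    then show ?thesis
      unfolding topY P_def by simp
  qed
  then have "closedin ?Y (I 0 \<union> (\<Union>i\<in>{1..r}. P i))"
    using closedI[of 0] by (intro closedin_Un closedin_Union) auto
  then have "openin ?Y V'"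
    unfolding V'_def by (metis closedin_def topY)
  then have V': "openin mtopology V'"
    using V openin_trans_full by metis
  have V'V: "V' \<subseteq> V"
    by (auto simp: V'_def)
  have frV': "mtopology frontier_of V' = mtopology closure_of V' - V'"
    using V' by (simp add: frontier_of_def interior_of_openin)
  have VW: "V - V' \<subseteq> W"
  proof
    fix x assume x: "x \<in> V - V'"
    show "x \<in> W"
    proof (cases "x \<in> I 0")
      case False
      then obtain i where "i \<in> {1..r}" "x \<in> P i"
        using x by (auto simp: V'_def)
      then have "f x \<noteq> 0"
        by (auto simp: P_def)
      then show ?thesis
        using f0[of x] x by blast
    qed (use IW[of 0] in auto)
  qed
  have IV': "I 0 \<subseteq> mtopology closure_of V'"
  proof
    fix x assume x: "x \<in> I 0"
    then have xV: "x \<in> V"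
      using IW[of 0] W(2) by auto
    have "x \<notin> mtopology derived_set_of I 0"
      using dI[of 0] frV xV by simp
    moreover have "x \<in> topspace mtopology"
      using xV VM by auto
    ultimately obtain O1 where O1: "x \<in> O1" "openin mtopology O1" "\<forall>y\<in>I 0 \<inter> O1. y = x"
      unfolding in_derived_set_of by blast
    \<comment> \<open>Near \<open>x\<close> there are other points, since \<open>x\<close> is not isolated; close enough to \<open>x\<close>, they
        are not in \<open>I 0\<close>, and \<open>f\<close> is too small there for any \<open>P i\<close>.\<close>
    have "\<exists>y. y \<in> V' \<and> y \<in> O'" if O': "x \<in> O'" "openin mtopology O'" for O'
    proof -
      let ?O = "O' \<inter> (O1 \<inter> {x \<in> V. \<bar>f x - 0\<bar> < 1/2})"
      have xO: "x \<in> ?O"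
        using O' O1(1) xV fI[of 0 x] x by simp
      moreover have "openin mtopology ?O"
        using O'(2) O1(2) open_pre by (intro openin_Int)
      ultimately have "x \<in> mtopology derived_set_of ?O"
        using dense_in_itself_open_subset_derived_set[OF X] by blast
      then obtain y where y: "y \<noteq> x" "y \<in> ?O"
        using in_derived_set_ofD[of x ?O 1] zero_less_one by metis
      then have "y \<notin> I 0"
        using O1(3) by blast
      moreover have "y \<notin> P i" if "i \<in> {1..r}" for i
        using y(2) apart[of "f y" 0 i] that by (auto simp: P_def)
      ultimately show ?thesis
        using y(2) by (auto simp: V'_def)
    qed
    then show "x \<in> mtopology closure_of V'"
      using xV VM by (auto simp: in_closure_of)
  qed
  have PV': "P i - N i \<subseteq> mtopology closure_of V'" if i: "i \<in> {1..r}" for i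
  proof
    fix x assume x: "x \<in> P i - N i"
    then have xV: "x \<in> V" and fx: "\<bar>f x - real i\<bar> \<le> 1/3"
      by (auto simp: P_def)
    have "\<exists>y. y \<in> V' \<and> y \<in> O'" if O': "x \<in> O'" "openin mtopology O'" for O'
    proof -
      let ?O = "O' \<inter> {x \<in> V. \<bar>f x - real i\<bar> < 1/2}"
      have xO: "x \<in> ?O"
        using O' xV fx by auto
      moreover have "openin mtopology ?O"
        using O' open_pre by blast
      ultimately have "\<not> ?O \<subseteq> P i"
        using x interior_of_maximal[of ?O "P i" mtopology] unfolding N_def by blast
      then obtain y where y: "y \<in> ?O" "y \<notin> P i"
        by blast
      then have fy: "\<bar>f y - real i\<bar> < 1/2"
        by blast
      have "y \<notin> I 0"
        using fI[of 0 y] fy apart[of "f y" i 0] i by auto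
      moreover have "y \<notin> P j" for j
        using y(2) apart[OF fy, of j] by (auto simp: P_def)
      ultimately show ?thesis
        using y(1) by (auto simp: V'_def)
    qed
    then show "x \<in> mtopology closure_of V'"
      using xV VM by (auto simp: in_closure_of)
  qed
  have IN: "I i \<subseteq> N i" if "i \<in> {1..r}" for i
  proof -
    have "I i \<subseteq> {x \<in> V. \<bar>f x - real i\<bar> < 1/3}"
      using fI[of i] IW[of i] W(2) that by auto
    also have "\<dots> \<subseteq> N i"
      unfolding N_def by (rule interior_of_maximal[OF _ open_pre]) (auto simp: P_def)
    finally show ?thesis .
  qed
  have F_dI: "?F \<subseteq> mtopology closure_of I i" if "i \<in> {0..r}" for i
    using dI[OF that] derived_set_of_subset_closure_of by metis
  have "carves r V W V' (I 0) N"
    unfolding carves_def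
  proof (intro conjI ballI)
    have "mtopology closure_of I 0 \<subseteq> mtopology closure_of V'"
      using closure_of_mono[OF IV', of mtopology] by simp
    then have "?F \<subseteq> mtopology closure_of V'"
      using F_dI[of 0] by auto
    then show "?F \<subseteq> mtopology frontier_of V'"
      using frV frV' V'V by blast
    have "V - V' \<subseteq> I 0 \<union> (\<Union>i\<in>{1..r}. P i)"
      by (auto simp: V'_def)
    then show "V - V' - (\<Union>i\<in>{1..r}. N i) \<subseteq> mtopology frontier_of V'"
      using IV' PV' unfolding frV' by blast
    show "I 0 \<subseteq> V \<inter> mtopology frontier_of V'"
      using IV' IW[of 0] W(2) unfolding frV' by (auto simp: V'_def)
    show "?F \<subseteq> mtopology derived_set_of I 0"
      using dI[of 0] by simp
    have "N i \<inter> N j = {}" if "i \<noteq> j" for i j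
    proof -
      have "\<not> (x \<in> P i \<and> x \<in> P j)" for x
        using that apart[of "f x" i j] unfolding P_def by fastforce
      then show ?thesis
        using NP[of i] NP[of j] by blast
    qed
    then show "disjoint_family_on N {1..r}"
      by (simp add: disjoint_family_on_def)
    fix i assume i: "i \<in> {1..r}"
    show "openin mtopology (N i)"
      by (simp add: N_def)
    have "P i \<subseteq> V - V'"
      using i by (auto simp: V'_def P_def)
    then show "N i \<subseteq> V - V'"
      using NP by blast
    show "?F \<subseteq> mtopology closure_of N i"
      using F_dI[of i] closure_of_mono[OF IN[OF i]] i by auto
  qed (use V' V'V VW in auto)
  then show ?thesis by blast
qed

section \<open>Iterating the step\<close>

text \<open>The frontier of an open set may be empty, and then no sets can accumulate at it. Deleting a point, which
is not isolated, provides a non-empty frontier for the construction to start from.\<close>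

lemma frontier_of_open_delete_point:
  assumes X: "dense_in_itself mtopology" and G: "openin mtopology G" "x \<in> G"
  shows "openin mtopology (G - {x})"
    and "mtopology frontier_of (G - {x}) = insert x (mtopology closure_of G - G)"
proof -
  have xM: "x \<in> M"
    using openin_subset[OF G(1)] G(2) by auto
  show op: "openin mtopology (G - {x})"
    using G(1) xM by (simp add: openin_diff closedin_Hausdorff_singleton Hausdorff_space_mtopology)
  have "x \<in> mtopology derived_set_of G"
    using dense_in_itself_open_subset_derived_set[OF X G(1)] G(2) by blast
  then have x: "x \<in> mtopology closure_of (G - {x})"
    unfolding in_closure_of in_derived_set_of by blast
  have "mtopology closure_of G = mtopology closure_of {x} \<union> mtopology closure_of (G - {x})"
    using G(2) by (metis closure_of_Un insert_Diff insert_is_Un)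
  also have "mtopology closure_of {x} = {x}"
    using xM by (simp add: closure_of_closedin closedin_Hausdorff_singleton Hausdorff_space_mtopology)
  finally have "mtopology closure_of G = mtopology closure_of (G - {x})"
    using x by auto
  then show "mtopology frontier_of (G - {x}) = insert x (mtopology closure_of G - G)"
    using op x by (auto simp: frontier_of_def interior_of_openin)
qed

text \<open>Each frontier point is a limit of points of \<open>V\<close>, and those close enough to it lie in the strip of width
\<open>e\<close>; so the strip can play the part of \<open>W\<close>.\<close>

lemma exists_carving_near_frontier:
  assumes X: "dense_in_itself mtopology" and V: "openin mtopology V" "mtopology frontier_of V \<noteq> {}"
    and e: "e > 0"
  shows "\<exists>V' E N. carves r V {x \<in> V. \<exists>y\<in>mtopology frontier_of V. d y x < e} V' E N"
proof -
  let ?F = "mtopology frontier_of V"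
  let ?W = "{x \<in> V. \<exists>y\<in>?F. d y x < e}"
  have VM: "V \<subseteq> M"
    using openin_subset[OF V(1)] by simp
  have FM: "?F \<subseteq> M"
    using frontier_of_subset_topspace[of mtopology V] by simp
  have "x \<in> mball y e \<longleftrightarrow> d y x < e" if "x \<in> V" "y \<in> ?F" for x y
    using that VM FM by auto
  then have W: "?W = V \<inter> (\<Union>y\<in>?F. mball y e)"
    by blast
  have "openin mtopology (\<Union>y\<in>?F. mball y e)"
    by (intro openin_Union) auto
  then have openW: "openin mtopology ?W" and nbhd: "openin mtopology (\<Union>y\<in>?F. mball y e)"
    unfolding W using V(1) by auto
  have "?F \<subseteq> (\<Union>y\<in>?F. mball y e)"
    using FM e by force
  moreover have "?F \<subseteq> mtopology closure_of V"
    by (simp add: frontier_of_def)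
  ultimately have "?F \<subseteq> (\<Union>y\<in>?F. mball y e) \<inter> mtopology closure_of V"
    by (rule Int_greatest)
  also have "\<dots> \<subseteq> mtopology closure_of ?W"
    unfolding W Int_commute[of V] by (rule openin_Int_closure_of_subset[OF nbhd])
  finally have FW: "?F \<subseteq> mtopology closure_of ?W" .
  show ?thesis
    by (rule exists_carving[OF X V(1) openW _ V(2) FW]) simp
qed

text \<open>Iterate the step inside strips of width \<open>1/(n+1)\<close> along the frontiers of the sets \<open>V n\<close>, and let \<open>D\<close>
be the closure of the union of these frontiers. Being a limit of \<open>G \<inter> D\<close>, or of a colour class of the
sets \<open>N n i\<close>, is a closed condition, so it suffices to know it for each frontier separately, and
there the next step provides it.\<close>

lemma exists_common_frontier_family:
  fixes r :: nat
  assumes X: "dense_in_itself mtopology" and G: "openin mtopology G" "G \<noteq> {}" and r: "r > 0"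
  shows "\<exists>D N. closedin mtopology D \<and> D \<noteq> {} \<and> D \<subseteq> mtopology closure_of G \<and>
    D \<subseteq> mtopology derived_set_of (G \<inter> D) \<and>
    mtopology closure_of G - D = (\<Union>i\<in>{1..r}. N i) \<and> disjoint_family_on N {1..r} \<and>
    (\<forall>i\<in>{1..r}. openin mtopology (N i) \<and> N i \<subseteq> G \<and> D \<subseteq> mtopology closure_of N i)"
proof -
  let ?fr = "\<lambda>V. mtopology frontier_of V"
  define near where "near n V = {x \<in> V. \<exists>y\<in>?fr V. d y x < 1 / Suc n}" for n and V :: "'a set"
  obtain x0 where x0: "x0 \<in> G"
    using G(2) by auto
  define V0 where "V0 = G - {x0}"
  have V0: "openin mtopology V0" and frV0: "?fr V0 = insert x0 (mtopology closure_of G - G)"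
    using frontier_of_open_delete_point[OF X G(1) x0] by (simp_all add: V0_def)
  define P where "P n V \<longleftrightarrow> openin mtopology V \<and> ?fr V \<noteq> {} \<and> (n = 0 \<longrightarrow> V = V0)" for n :: nat and V
  have "\<exists>V. \<forall>n. P n (V n) \<and> (\<exists>E N. carves r (V n) (near n (V n)) (V (Suc n)) E N)"
  proof (rule dependent_nat_choice)
    show "\<exists>V. P 0 V"
      using V0 frV0 by (auto simp: P_def)
    fix V n assume "P n V"
    then obtain V' E N where c: "carves r V (near n V) V' E N" and "?fr V \<noteq> {}"
      using exists_carving_near_frontier[OF X, of V "1 / Suc n" r] by (auto simp: P_def near_def)
    then have "P (Suc n) V'"
      by (auto simp: P_def carves_def)
    then show "\<exists>V'. P (Suc n) V' \<and> (\<exists>E N. carves r V (near n V) V' E N)"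
      using c by blast
  qed
  then obtain V E N where "\<And>n. P n (V n)"
     and carves: "\<And>n. carves r (V n) (near n (V n)) (V (Suc n)) (E n) (N n)"
    by metis
  then have openV: "openin mtopology (V n)" and V_0: "V 0 = V0" for n
    by (auto simp: P_def)
  note c = carves[unfolded carves_def]
  have VSuc: "V (Suc n) \<subseteq> V n" and V_near: "V n - V (Suc n) \<subseteq> near n (V n)"
    and F_Suc: "?fr (V n) \<subseteq> ?fr (V (Suc n))"
    and V_step: "V n - V (Suc n) - (\<Union>i\<in>{1..r}. N n i) \<subseteq> ?fr (V (Suc n))"
    and E: "E n \<subseteq> V n \<inter> ?fr (V (Suc n))" and dE: "?fr (V n) \<subseteq> mtopology derived_set_of E n"
    and Ndisj: "disjoint_family_on (N n) {1..r}" for n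
    using c[of n] by simp_all
  have N: "openin mtopology (N n i)" "N n i \<subseteq> V n - V (Suc n)" "?fr (V n) \<subseteq> mtopology closure_of N n i"
    if "i \<in> {1..r}" for n i
    using c[of n] that by simp_all
  have V_anti: "V n \<subseteq> V m" if "m \<le> n" for m n
    using VSuc that by (rule lift_Suc_antimono_le)
  have F_mono: "?fr (V m) \<subseteq> ?fr (V n)" if "m \<le> n" for m n
    using F_Suc that by (rule lift_Suc_mono_le)
  have VG: "V n \<subseteq> G" for n
    using V_anti[of 0 n] by (auto simp: V_0 V0_def)
  have frV: "?fr (V n) = mtopology closure_of (V n) - V n" for n
    using openV[of n] by (simp add: frontier_of_def interior_of_openin)
  have GM: "G \<subseteq> M"
    using openin_subset[OF G(1)] by simp
  define D where "D = mtopology closure_of (\<Union>n. ?fr (V n))"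
  have D_least: "D \<subseteq> C" if "closedin mtopology C" "\<And>n. ?fr (V n) \<subseteq> C" for C
    unfolding D_def using that by (intro closure_of_minimal) auto
  have FD: "?fr (V n) \<subseteq> D" for n
  proof -
    have "(\<Union>n. ?fr (V n)) \<subseteq> topspace mtopology"
      using frontier_of_subset_topspace[of mtopology] by (intro UN_least)
    then show ?thesis
      unfolding D_def using closure_of_subset by blast
  qed
  have D: "closedin mtopology D"
    by (simp add: D_def)
  have ND: "N m i \<inter> D = {}" if i: "i \<in> {1..r}" for m i
  proof -
    \<comment> \<open>Up to step \<open>m\<close> the frontiers avoid \<open>V m\<close>; afterwards they lie in the closure of sets
        \<open>V n\<close> that avoid the open set \<open>N m i\<close>.\<close>
    have "N m i \<inter> ?fr (V n) = {}" for n
    proof (cases "n \<le> m")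
      case True
      have "?fr (V n) \<inter> V m = {}"
        using F_mono[OF True] frV[of m] by blast
      then show ?thesis
        using N(2)[OF i, of m] by blast
    next
      case False
      then have "N m i \<inter> V n = {}"
        using V_anti[of "Suc m" n] N(2)[OF i, of m] by auto
      then have "N m i \<inter> mtopology closure_of (V n) = {}"
        using openin_Int_closure_of_eq_empty[OF N(1)[OF i]] by blast
      then show ?thesis
        unfolding frV by blast
    qed
    then have "N m i \<inter> (\<Union>n. ?fr (V n)) = {}"
      by blast
    then show ?thesis
      unfolding D_def using openin_Int_closure_of_eq_empty[OF N(1)[OF i]] by blast
  qed
  \<comment> \<open>The points that are never removed. Any one of the open sets may take them; below the first does.\<close>
  define L where "L = (\<Inter>n. V n) - D"
  have openL: "openin mtopology L"
    unfolding openin_mtopology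
  proof (intro conjI allI impI)
    show "L \<subseteq> M"
      using VG[of 0] GM by (auto simp: L_def)
    fix y assume y: "y \<in> L"
    then have yM: "y \<in> M"
      using \<open>L \<subseteq> M\<close> by auto
    have "openin mtopology (M - D)"
      using D by (metis closedin_def topspace_mtopology)
    then obtain \<delta> where \<delta>: "\<delta> > 0" "mball y \<delta> \<subseteq> M - D"
      using y yM openin_mtopology unfolding L_def by (metis DiffD2 DiffI)
    obtain n where n: "1 / Suc n < \<delta> / 2"
      using \<delta>(1) nat_approx_posE[of "\<delta>/2"] by auto
    have "y \<in> V n"
      using y by (auto simp: L_def)
    then obtain \<rho> where \<rho>: "\<rho> > 0" "mball y \<rho> \<subseteq> V n"
      using openV[of n] openin_mtopology by metis
    \<comment> \<open>From step \<open>n\<close> on, only points within \<open>\<delta>/2\<close> of \<open>D\<close> are removed, and the \<open>\<delta>/2\<close>-ball around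
        \<open>y\<close> contains none.\<close>
    have "z \<in> L" if z: "z \<in> mball y (min \<rho> (\<delta>/2))" for z
    proof -
      have z\<rho>: "z \<in> mball y \<rho>" and z\<delta>: "d y z < \<delta> / 2" and zM: "z \<in> M"
        using z by auto
      have late: "z \<in> V m" if "n \<le> m" for m
        using that
      proof (induction m rule: dec_induct)
        case base
        then show ?case using \<rho>(2) z\<rho> by blast
      next
        case (step m)
        show ?case
        proof (rule ccontr)
          assume "z \<notin> V (Suc m)"
          then have "z \<in> near m (V m)"
            using V_near[of m] step.IH by blast
          then obtain x where x: "x \<in> ?fr (V m)" "d z x < 1 / Suc m"
            by (auto simp: near_def commute[of z])
          have xM: "x \<in> M"
            using frontier_of_subset_topspace[of mtopology "V m"] x(1) by auto
          have "1 / real (Suc m) \<le> 1 / Suc n"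
            using step.hyps by (simp add: frac_le)
          then have "d y x < \<delta>"
            using triangle[OF yM zM xM] x(2) n z\<delta> by linarith
          then have "x \<in> mball y \<delta>"
            using yM xM by simp
          then show False
            using \<delta>(2) x(1) FD[of m] by blast
        qed
      qed
      have "z \<in> V m" for m
        using late[of "max m n"] V_anti[of m "max m n"] by auto
      moreover have "z \<in> mball y \<delta>"
        using z\<delta> \<delta>(1) yM zM by simp
      ultimately show ?thesis
        using \<delta>(2) by (auto simp: L_def)
    qed
    then show "\<exists>s>0. mball y s \<subseteq> L"
      using \<rho>(1) \<delta>(1) by (intro exI[of _ "min \<rho> (\<delta>/2)"]) auto
  qed
  have LN: "L \<inter> N m i = {}" if "i \<in> {1..r}" for m i
    using N(2)[OF that, of m] by (auto simp: L_def)
  have cover: "x \<in> L \<or> (\<exists>m. \<exists>i\<in>{1..r}. x \<in> N m i)" if x: "x \<in> G" "x \<notin> D" for x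
  proof (rule ccontr)
    assume neg: "\<not> ?thesis"
    have "x \<in> V n" for n
    proof (induction n)
      case 0
      have "x0 \<in> D"
        using FD[of 0] frV0 V_0 by auto
      then show ?case
        using x by (auto simp: V_0 V0_def)
    next
      case (Suc n)
      then show ?case
        using V_step[of n] FD[of "Suc n"] x(2) neg by blast
    qed
    then show False
      using neg x(2) by (auto simp: L_def)
  qed
  have clG: "mtopology closure_of G - G \<subseteq> D"
    using FD[of 0] frV0 V_0 by auto
  define O' where "O' i = (\<Union>m. N m i) \<union> (if i = 1 then L else {})" for i
  have NO: "N m i \<subseteq> O' i" for m i
    by (auto simp: O'_def)
  have NN: "N m i \<inter> N n j = {}" if ij: "i \<in> {1..r}" "j \<in> {1..r}" "i \<noteq> j" for m n i j
  proof -
    consider "m = n" | "Suc m \<le> n" | "Suc n \<le> m"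
      by linarith
    then show ?thesis
    proof cases
      case 1
      then show ?thesis
        using Ndisj[of n] ij by (auto simp: disjoint_family_on_def)
    next
      case 2
      then show ?thesis
        using V_anti[OF 2] N(2)[OF ij(1), of m] N(2)[OF ij(2), of n] by blast
    next
      case 3
      then show ?thesis
        using V_anti[OF 3] N(2)[OF ij(1), of m] N(2)[OF ij(2), of n] by blast
    qed
  qed
  show ?thesis
  proof (intro exI[of _ D] exI[of _ O'] conjI ballI)
    show "closedin mtopology D" by fact
    show "D \<noteq> {}"
      using FD[of 0] frV0 V_0 by auto
    have "?fr (V n) \<subseteq> mtopology closure_of G" for n
      using closure_of_mono[OF VG[of n], of mtopology] frV[of n] by blast
    then show "D \<subseteq> mtopology closure_of G"
      by (intro D_least) auto
    have "E n \<subseteq> G \<inter> D" for n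
      using E[of n] VG[of n] FD[of "Suc n"] by blast
    then have "?fr (V n) \<subseteq> mtopology derived_set_of (G \<inter> D)" for n
      using dE[of n] derived_set_of_mono[of "E n" "G \<inter> D" mtopology] by blast
    then show "D \<subseteq> mtopology derived_set_of (G \<inter> D)"
      by (intro D_least closedin_derived_set_of Hausdorff_space_mtopology)
    have OG: "O' i \<subseteq> G" and OD: "O' i \<inter> D = {}" if "i \<in> {1..r}" for i
    proof -
      have "N m i \<subseteq> G" for m
        using N(2)[OF that, of m] VG[of m] by blast
      moreover have "L \<subseteq> G"
        using VG[of 0] by (auto simp: L_def)
      ultimately show "O' i \<subseteq> G"
        by (auto simp: O'_def)
      show "O' i \<inter> D = {}"
        using ND[OF that] by (auto simp: O'_def L_def)
    qed
    show "mtopology closure_of G - D = (\<Union>i\<in>{1..r}. O' i)"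
    proof
      show "mtopology closure_of G - D \<subseteq> (\<Union>i\<in>{1..r}. O' i)"
      proof
        fix x assume "x \<in> mtopology closure_of G - D"
        then consider "x \<in> L" | m i where "i \<in> {1..r}" "x \<in> N m i"
          using cover[of x] clG by blast
        then show "x \<in> (\<Union>i\<in>{1..r}. O' i)"
        proof cases
          case 1
          then have "x \<in> O' 1" by (simp add: O'_def)
          moreover have "1 \<in> {1..r}" using r by simp
          ultimately show ?thesis by blast
        next
          case 2
          then show ?thesis using NO[of m i] by blast
        qed
      qed
      have "G \<subseteq> mtopology closure_of G"
        using GM by (simp add: closure_of_subset)
      then show "(\<Union>i\<in>{1..r}. O' i) \<subseteq> mtopology closure_of G - D"
        using OG OD by blast
    qed
    have "O' i \<inter> O' j = {}" if "i \<in> {1..r}" "j \<in> {1..r}" "i \<noteq> j" for i j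
      using NN[OF that] LN[OF that(1)] LN[OF that(2)] that(3)
      unfolding O'_def by (auto simp: disjoint_iff)
    then show "disjoint_family_on O' {1..r}"
      unfolding disjoint_family_on_def by blast
    fix i assume i: "i \<in> {1..r}"
    show "openin mtopology (O' i)"
      using openL N(1)[OF i] unfolding O'_def by (intro openin_Un openin_Union) auto
    show "O' i \<subseteq> G"
      using OG[OF i] .
    have "?fr (V n) \<subseteq> mtopology closure_of O' i" for n
      using N(3)[OF i, of n] closure_of_mono[OF NO[of n i], of mtopology] by blast
    then show "D \<subseteq> mtopology closure_of O' i"
      by (intro D_least) auto
  qed
qed

text \<open>An open set disjoint from the other \<open>N l\<close> has closure disjoint from them, so the closure of \<open>N i\<close> adds
to \<open>N i\<close> only points of \<open>D\<close>, and all of them. As \<open>G \<inter> D\<close> has derived set \<open>D\<close>, it splits into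
the sets \<open>B j\<close>. For \<open>r = 0\<close> one takes \<open>D = cl G\<close>: then \<open>G \<inter> D = G\<close>, which has no isolated points.\<close>

proposition exists_open_dissection:
  assumes X: "dense_in_itself mtopology" and G: "openin mtopology G" "G \<noteq> {}"
  obtains N B :: "nat \<Rightarrow> 'a set" where
    "(\<Union>i\<in>{1..r}. N i) \<union> (\<Union>j\<in>{0..s}. B j) = G"
    "disjoint_family_on N {1..r}" "disjoint_family_on B {0..s}"
    "\<And>i j. i \<in> {1..r} \<Longrightarrow> j \<in> {0..s} \<Longrightarrow> N i \<inter> B j = {}"
    "\<And>i. i \<in> {1..r} \<Longrightarrow> openin mtopology (N i)" "\<And>i. i \<in> {1..r} \<Longrightarrow> N i \<noteq> {}"
    "\<And>j. j \<in> {0..s} \<Longrightarrow> B j \<noteq> {}"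
    "\<And>i. i \<in> {1..r} \<Longrightarrow> mtopology closure_of N i - N i = mtopology closure_of G - (\<Union>l\<in>{1..r}. N l)"
    "\<And>j. j \<in> {0..s} \<Longrightarrow> mtopology derived_set_of B j = mtopology closure_of G - (\<Union>l\<in>{1..r}. N l)"
proof -
  have GM: "G \<subseteq> M"
    using openin_subset[OF G(1)] by simp
  have Gcl: "G \<subseteq> mtopology closure_of G"
    using GM by (simp add: closure_of_subset)
  have "\<exists>D N. closedin mtopology D \<and> D \<noteq> {} \<and> D \<subseteq> mtopology closure_of G \<and>
    D \<subseteq> mtopology derived_set_of (G \<inter> D) \<and>
    mtopology closure_of G - D = (\<Union>i\<in>{1..r}. N i) \<and> disjoint_family_on N {1..r} \<and>
    (\<forall>i\<in>{1..r}. openin mtopology (N i) \<and> N i \<subseteq> G \<and> D \<subseteq> mtopology closure_of N i)"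
  proof (cases "r = 0")
    case True
    have "mtopology closure_of G \<subseteq> mtopology derived_set_of G"
      using dense_in_itself_open_subset_derived_set[OF X G(1)]
      by (simp add: closure_of_minimal closedin_derived_set_of Hausdorff_space_mtopology)
    then show ?thesis
      using True G(2) Gcl
      by (intro exI[of _ "mtopology closure_of G"] exI[of _ "\<lambda>_. {}"])
         (auto simp: Int_absorb2 disjoint_family_on_def)
  next
    case False
    then have "r > 0" by simp
    show ?thesis
      by (rule exists_common_frontier_family[OF X G \<open>r > 0\<close>])
  qed
  then obtain D N where D: "closedin mtopology D" "D \<noteq> {}" "D \<subseteq> mtopology closure_of G"
      "D \<subseteq> mtopology derived_set_of (G \<inter> D)"
      and DN: "mtopology closure_of G - D = (\<Union>i\<in>{1..r}. N i)" and Ndisj: "disjoint_family_on N {1..r}"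
      and N': "\<forall>i\<in>{1..r}. openin mtopology (N i) \<and> N i \<subseteq> G \<and> D \<subseteq> mtopology closure_of N i"
    by (elim exE conjE)
  have N: "openin mtopology (N i)" "N i \<subseteq> G" "D \<subseteq> mtopology closure_of N i" if "i \<in> {1..r}" for i
    using N' that by simp_all
  have D_eq: "D = mtopology closure_of G - (\<Union>l\<in>{1..r}. N l)"
    using D(3) DN by blast
  have dGD: "mtopology derived_set_of (G \<inter> D) = D"
  proof
    have "mtopology derived_set_of D \<subseteq> D"
      using D(1) by (simp add: closedin_contains_derived_set)
    then show "mtopology derived_set_of (G \<inter> D) \<subseteq> D"
      using derived_set_of_mono[of "G \<inter> D" D mtopology] by blast
  qed (rule D(4))
  have "G \<inter> D \<subseteq> M"
    using GM by blast
  then obtain B :: "nat \<Rightarrow> 'a set" where B: "disjoint_family_on B {0..s}" "(\<Union>j\<in>{0..s}. B j) = G \<inter> D"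
     and "\<And>j. j \<in> {0..s} \<Longrightarrow> mtopology derived_set_of B j = mtopology derived_set_of (G \<inter> D)"
    using split_preserving_derived_set[of "G \<inter> D" s] by metis
  then have dB: "mtopology derived_set_of B j = D" if "j \<in> {0..s}" for j
    using dGD that by simp
  show ?thesis
  proof (rule that[of N B])
    have NG: "(\<Union>i\<in>{1..r}. N i) \<subseteq> G"
      using N(2) by blast
    then show "(\<Union>i\<in>{1..r}. N i) \<union> (\<Union>j\<in>{0..s}. B j) = G"
      unfolding B(2) using DN Gcl by blast
    show "N i \<inter> B j = {}" if "i \<in> {1..r}" "j \<in> {0..s}" for i j
      using B(2) DN that by blast
    show "openin mtopology (N i)" if "i \<in> {1..r}" for i
      using N(1)[OF that] .
    show "N i \<noteq> {}" if "i \<in> {1..r}" for i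
      using N(3)[OF that] D(2) by auto
    show "B j \<noteq> {}" if "j \<in> {0..s}" for j
      using dB[OF that] D(2) by auto
    show "mtopology derived_set_of B j = mtopology closure_of G - (\<Union>l\<in>{1..r}. N l)" if "j \<in> {0..s}" for j
      using dB[OF that] D_eq by simp
    show "mtopology closure_of N i - N i = mtopology closure_of G - (\<Union>l\<in>{1..r}. N l)" if i: "i \<in> {1..r}" for i
    proof -
      have "mtopology closure_of N i \<inter> N l = {}" if "l \<in> {1..r}" "l \<noteq> i" for l
      proof -
        have "N l \<inter> N i = {}"
          using Ndisj i that by (simp add: disjoint_family_on_def)
        then show ?thesis
          using openin_Int_closure_of_eq_empty[OF N(1)[OF that(1)]] by blast
      qed
      moreover have "mtopology closure_of N i \<subseteq> mtopology closure_of G"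
        using closure_of_mono[OF N(2)[OF i]] .
      ultimately have "mtopology closure_of N i - N i \<subseteq> D"
        unfolding D_eq by blast
      moreover have "D \<subseteq> mtopology closure_of N i - N i"
        using N(3)[OF i] D_eq i by blast
      ultimately show ?thesis
        using D_eq by simp
    qed
  qed (use B(1) Ndisj in auto)
qed

end

theorem theorem7p8:
  fixes X :: "'a metric"
  assumes "dense_in_itself (mtopology_of X)"
  shows
   "(\<forall>(T :: 'a set) (U :: 'a set) (k :: nat).
       openin (mtopology_of X) T \<and> openin (mtopology_of X) U \<and> T \<noteq> {} \<and> T \<subseteq> U \<longrightarrow>
       (\<exists>I :: nat \<Rightarrow> 'a set.
          disjoint_family_on I {0..k} \<and>
          (\<forall>i\<in>{0..k}. I i \<noteq> {} \<and> I i \<subseteq> T \<and>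
             mtopology_of X derived_set_of I i = (mtopology_of X closure_of T) - U)))
    \<and>
    (\<forall>(G :: 'a set) (r :: nat) (s :: nat).
       openin (mtopology_of X) G \<and> G \<noteq> {} \<longrightarrow>
       (\<exists>(GG :: nat \<Rightarrow> 'a set) (B :: nat \<Rightarrow> 'a set).
          (\<Union>i\<in>{1..r}. GG i) \<union> (\<Union>j\<in>{0..s}. B j) = G \<and>
          disjoint_family_on GG {1..r} \<and>
          disjoint_family_on B {0..s} \<and>
          (\<forall>i\<in>{1..r}. \<forall>j\<in>{0..s}. GG i \<inter> B j = {}) \<and>
          (\<forall>i\<in>{1..r}. openin (mtopology_of X) (GG i) \<and> GG i \<noteq> {}) \<and>
          (\<forall>j\<in>{0..s}. B j \<noteq> {}) \<and>
          (let D = (mtopology_of X closure_of G) - (\<Union>l\<in>{1..r}. GG l) in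
             (\<forall>i\<in>{1..r}. (mtopology_of X closure_of GG i) - GG i = D) \<and>
             (\<forall>j\<in>{0..s}. mtopology_of X derived_set_of B j = D))))"
proof (intro conjI allI impI)
  interpret Metric_space "mspace X" "mdist X"
    by (rule Metric_space_mspace_mdist)
  have X: "dense_in_itself mtopology"
    using assms by (simp add: mtopology_of_def)
  fix T U :: "'a set" and k :: nat
  assume "openin (mtopology_of X) T \<and> openin (mtopology_of X) U \<and> T \<noteq> {} \<and> T \<subseteq> U"
  then have TU: "openin mtopology T" "T \<noteq> {}" "openin mtopology U" "T \<subseteq> U"
    by (simp_all add: mtopology_of_def)
  show "\<exists>I :: nat \<Rightarrow> 'a set.
          disjoint_family_on I {0..k} \<and>
          (\<forall>i\<in>{0..k}. I i \<noteq> {} \<and> I i \<subseteq> T \<and>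
             mtopology_of X derived_set_of I i = (mtopology_of X closure_of T) - U)"
    unfolding mtopology_of_def
    by (rule exists_disjoint_sets_derived_set_eq[OF X TU, of k]) blast
next
  interpret Metric_space "mspace X" "mdist X"
    by (rule Metric_space_mspace_mdist)
  have X: "dense_in_itself mtopology"
    using assms by (simp add: mtopology_of_def)
  fix G :: "'a set" and r s :: nat
  assume "openin (mtopology_of X) G \<and> G \<noteq> {}"
  then have G: "openin mtopology G" "G \<noteq> {}"
    by (simp_all add: mtopology_of_def)
  show "\<exists>(GG :: nat \<Rightarrow> 'a set) (B :: nat \<Rightarrow> 'a set).
          (\<Union>i\<in>{1..r}. GG i) \<union> (\<Union>j\<in>{0..s}. B j) = G \<and>
          disjoint_family_on GG {1..r} \<and>
          disjoint_family_on B {0..s} \<and>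
          (\<forall>i\<in>{1..r}. \<forall>j\<in>{0..s}. GG i \<inter> B j = {}) \<and>
          (\<forall>i\<in>{1..r}. openin (mtopology_of X) (GG i) \<and> GG i \<noteq> {}) \<and>
          (\<forall>j\<in>{0..s}. B j \<noteq> {}) \<and>
          (let D = (mtopology_of X closure_of G) - (\<Union>l\<in>{1..r}. GG l) in
             (\<forall>i\<in>{1..r}. (mtopology_of X closure_of GG i) - GG i = D) \<and>
             (\<forall>j\<in>{0..s}. mtopology_of X derived_set_of B j = D))"
    unfolding mtopology_of_def Let_def
    by (rule exists_open_dissection[OF X G, of r s]) (intro exI conjI ballI; simp)
qed

end
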